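(* For every hypersequent $G$: if $[\![G]\!]\geq 0$ is derivable in equational logic from the axioms of modal Riesz spaces (equivalently, holds in every modal Riesz space under every assignment of the variables), then $G$ is derivable in the hypersequent calculus $\mathbf{HMR}$.
   Context: Modal Riesz spaces: a modal Riesz space is a Riesz space (vector lattice) $V$ with a distinguished element $1$ and a map $\Diamond:V\to V$ satisfying $0\leq 1$, $\Diamond(r_1a+r_2b)=r_1\Diamond a+r_2\Diamond b$, $\Diamond(0\sqcup a)\geq 0$ and $\Diamond(1)\leq 1$. Terms. Fix a countable set of variables $x,y,\dots$. Terms (in negation normal form) are generated by $A ::= x \mid \overline{x} \mid 0 \mid 1 \mid \overline{1} \mid A+A \mid rA \mid A\sqcup A \mid A\sqcap A \mid \Diamond A$ with $r\in\mathbb{R}_{>0}$; they are interpreted in modal Riesz spaces reading $\overline{x}$ as $-x$ and $\overline{1}$ as $-1$. Negation: $\overline{x}$ for $x$, $\overline{\overline{x}}=x$, $\overline{0}=0$, $\overline 1$ for $1$, $\overline{\overline{1}}=1$, $\overline{A+B}=\overline A+\overline B$, $\overline{rA}=r\overline A$, $\overline{A\sqcup B}=\overline A\sqcap\overline B$, $\overline{A\sqcap B}=\overline A\sqcup\overline B$, $\overline{\Diamond A}=\Diamond\overline A$. A weighted term is $r.A$ ($r>0$); a sequent $\vdash\Gamma$ has $\Gamma$ a finite (possibly empty) multiset of weighted terms; a hypersequent is a nonempty finite multiset of sequents $\vdash\Gamma_1\mid\cdots\mid\vdash\Gamma_n$; $G\mid\vdash\Gamma$ adds a sequent. For a finite (possibly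 empty) sequence $\vec r=(r_1,\dots,r_n)$ of positive reals, $\vec r.A$ is the multiset $r_1.A,\dots,r_n.A$, $\sum\vec r=r_1+\dots+r_n$, $s\vec r=(sr_1,\dots,sr_n)$; $s.\Gamma$ multiplies all weights by $s>0$; if $\Gamma=r_1.A_1,\dots,r_n.A_n$ then $\Diamond\Gamma=r_1.\Diamond A_1,\dots,r_n.\Diamond A_n$. Interpretation: $[\![r.A]\!]=rA$, a sequent is the sum of its weighted terms (empty sum $0$), a hypersequent is the join of its sequents. The calculus $\mathbf{HMR}$ has the rules: INIT: $\vdash$ with no premises. W: from $G$ infer $G\mid\vdash\Gamma$. C: from $G\mid\vdash\Gamma\mid\vdash\Gamma$ infer $G\mid\vdash\Gamma$. S: from $G\mid\vdash\Gamma_1,\Gamma_2$ infer $G\mid\vdash\Gamma_1\mid\vdash\Gamma_2$. M: from $G\mid\vdash\Gamma_1$ and $G\mid\vdash\Gamma_2$ infer $G\mid\vdash\Gamma_1,\Gamma_2$. T: for $r>0$, from $G\mid\vdash r.\Gamma$ infer $G\mid\vdash\Gamma$. ID: if $\sum\vec r=\sum\vec s$, from $G\mid\vdash\Gamma$ infer $G\mid\vdash\Gamma,\vec r.x,\vec s.\overline{x}$ ($x$ a variable). 0: from $G\mid\vdash\Gamma$ infer $G\mid\vdash\Gamma,\vec r.0$. $+$: from $G\mid\vdash\Gamma,\vec r.A,\vec r.B$ infer $G\mid\vdash\Gamma,\vec r.(A+B)$. $\times$: from $G\mid\vdash\Gamma,(s\vec r).A$ infer $G\mid\vdash\Gamma,\vec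 r.(sA)$. $\sqcup$: from $G\mid\vdash\Gamma,\vec r.A\mid\vdash\Gamma,\vec r.B$ infer $G\mid\vdash\Gamma,\vec r.(A\sqcup B)$. $\sqcap$: from $G\mid\vdash\Gamma,\vec r.A$ and $G\mid\vdash\Gamma,\vec r.B$ infer $G\mid\vdash\Gamma,\vec r.(A\sqcap B)$. CAN: if $\sum\vec r=\sum\vec s$, from $G\mid\vdash\Gamma,\vec s.A,\vec r.\overline A$ infer $G\mid\vdash\Gamma$. 1: if $\sum\vec r\geq\sum\vec s$, from $G\mid\vdash\Gamma$ infer $G\mid\vdash\Gamma,\vec r.1,\vec s.\overline{1}$. $\Diamond$: if $\sum\vec r\geq\sum\vec s$, from the single-sequent hypersequent $\vdash\Gamma,\vec r.1,\vec s.\overline 1$ infer the single-sequent hypersequent $\vdash\Diamond\Gamma,\vec r.1,\vec s.\overline 1$. A derivation is a finite tree of rule instances whose leaves are INIT. *)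

theory Defs
  imports Complex_Main "HOL-Library.Multiset"
begin

section \<open>Modal Riesz spaces: terms and equational logic\<close>

text \<open>
  Terms over the signature of modal Riesz spaces: every real scalar is allowed, and minus
  is multiplication by the scalar -1.
\<close>

datatype tm =
    TVar nat
  | TZero
  | TOne
  | TAdd tm tm
  | TScale real tm
  | TJoin tm tm
  | TMeet tm tm
  | TDia tm

text \<open>
  The equational axioms. They are schematic in arbitrary terms, so the set of axioms is closed
  under substitution and the equational logic below needs no substitution rule.
  An inequality \<open>a \<le> b\<close> is the equation \<open>a \<sqinter> b = a\<close>.
\<close>

inductive mrs_axiom :: "tm \<Rightarrow> tm \<Rightarrow> bool" where
  add_assoc: "mrs_axiom (TAdd a (TAdd b c)) (TAdd (TAdd a b) c)"
| add_comm: "mrs_axiom (TAdd a b) (TAdd b a)"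
| add_zero: "mrs_axiom (TAdd a TZero) a"
| add_minus: "mrs_axiom (TAdd a (TScale (- 1) a)) TZero"
| scale_scale: "mrs_axiom (TScale r (TScale s a)) (TScale (r * s) a)"
| scale_one: "mrs_axiom (TScale 1 a) a"
| scale_add_right: "mrs_axiom (TScale r (TAdd a b)) (TAdd (TScale r a) (TScale r b))"
| scale_add_left: "mrs_axiom (TScale (r + s) a) (TAdd (TScale r a) (TScale s a))"
| join_assoc: "mrs_axiom (TJoin a (TJoin b c)) (TJoin (TJoin a b) c)"
| join_comm: "mrs_axiom (TJoin a b) (TJoin b a)"
| join_absorb: "mrs_axiom (TJoin a (TMeet a b)) a"
| meet_assoc: "mrs_axiom (TMeet a (TMeet b c)) (TMeet (TMeet a b) c)"
| meet_comm: "mrs_axiom (TMeet a b) (TMeet b a)"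
| meet_absorb: "mrs_axiom (TMeet a (TJoin a b)) a"
\<comment> \<open>\<open>(a \<sqinter> b) + c \<le> b + c\<close> and \<open>r (a \<sqinter> b) \<le> r b\<close>: monotonicity of addition and of nonnegative scaling\<close>
| add_mono: "mrs_axiom (TMeet (TAdd (TMeet a b) c) (TAdd b c)) (TAdd (TMeet a b) c)"
| scale_mono: "r \<ge> 0 \<Longrightarrow>
    mrs_axiom (TMeet (TScale r (TMeet a b)) (TScale r b)) (TScale r (TMeet a b))"
| zero_le_one: "mrs_axiom (TMeet TZero TOne) TZero"
| dia_linear: "mrs_axiom (TDia (TAdd (TScale r a) (TScale s b)))
    (TAdd (TScale r (TDia a)) (TScale s (TDia b)))"
| dia_pos: "mrs_axiom (TMeet TZero (TDia (TJoin TZero a))) TZero"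
| dia_one: "mrs_axiom (TMeet (TDia TOne) TOne) (TDia TOne)"

inductive mrs_eq :: "tm \<Rightarrow> tm \<Rightarrow> bool" (infix "\<approx>" 50) where
  ax: "mrs_axiom a b \<Longrightarrow> a \<approx> b"
| refl: "a \<approx> a"
| sym: "a \<approx> b \<Longrightarrow> b \<approx> a"
| trans: "a \<approx> b \<Longrightarrow> b \<approx> c \<Longrightarrow> a \<approx> c"
| cong_add: "a \<approx> a' \<Longrightarrow> b \<approx> b' \<Longrightarrow> TAdd a b \<approx> TAdd a' b'"
| cong_scale: "a \<approx> a' \<Longrightarrow> TScale r a \<approx> TScale r a'"
| cong_join: "a \<approx> a' \<Longrightarrow> b \<approx> b' \<Longrightarrow> TJoin a b \<approx> TJoin a' b'"
| cong_meet: "a \<approx> a' \<Longrightarrow> b \<approx> b' \<Longrightarrow> TMeet a b \<approx> TMeet a' b'"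
| cong_dia: "a \<approx> a' \<Longrightarrow> TDia a \<approx> TDia a'"

definition mrs_le :: "tm \<Rightarrow> tm \<Rightarrow> bool" (infix "\<lesssim>" 50) where
  "a \<lesssim> b \<longleftrightarrow> TMeet a b \<approx> a"


section \<open>Terms in negation normal form and hypersequents\<close>

typedef posreal = "{r :: real. r > 0}" morphisms real_of_posreal Posreal
  by (rule exI[of _ 1]) simp

instantiation posreal :: times
begin

definition times_posreal :: "posreal \<Rightarrow> posreal \<Rightarrow> posreal" where
  "r * s = Posreal (real_of_posreal r * real_of_posreal s)"

instance ..

end

lemma real_of_posreal_pos: "real_of_posreal r > 0"
  using real_of_posreal[of r] by simp

lemma real_of_posreal_times: "real_of_posreal (r * s) = real_of_posreal r * real_of_posreal s"
  by (simp add: times_posreal_def Posreal_inverse real_of_posreal_pos)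

datatype nnf =
    Var nat
  | NVar nat
  | Zero
  | One
  | NOne
  | Add nnf nnf
  | Scale posreal nnf
  | Join nnf nnf
  | Meet nnf nnf
  | Dia nnf

primrec neg :: "nnf \<Rightarrow> nnf" where
  "neg (Var x) = NVar x"
| "neg (NVar x) = Var x"
| "neg Zero = Zero"
| "neg One = NOne"
| "neg NOne = One"
| "neg (Add A B) = Add (neg A) (neg B)"
| "neg (Scale r A) = Scale r (neg A)"
| "neg (Join A B) = Meet (neg A) (neg B)"
| "neg (Meet A B) = Join (neg A) (neg B)"
| "neg (Dia A) = Dia (neg A)"

type_synonym sequent = "(posreal \<times> nnf) multiset"

text \<open>The rules below only derive nonempty hypersequents; the type itself also contains the empty one.\<close>

type_synonym hypersequent = "sequent multiset"

definition wsum :: "posreal list \<Rightarrow> real" where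
  "wsum rs = (\<Sum>r\<leftarrow>rs. real_of_posreal r)"

definition wvec :: "posreal list \<Rightarrow> nnf \<Rightarrow> sequent" where
  "wvec rs A = mset (map (\<lambda>r. (r, A)) rs)"

definition wscale :: "posreal \<Rightarrow> sequent \<Rightarrow> sequent" where
  "wscale s \<Gamma> = image_mset (\<lambda>(r, A). (s * r, A)) \<Gamma>"

definition wdia :: "sequent \<Rightarrow> sequent" where
  "wdia \<Gamma> = image_mset (\<lambda>(r, A). (r, Dia A)) \<Gamma>"


section \<open>Interpretation\<close>

primrec nnf_tm :: "nnf \<Rightarrow> tm" where
  "nnf_tm (Var x) = TVar x"
| "nnf_tm (NVar x) = TScale (- 1) (TVar x)"
| "nnf_tm Zero = TZero"
| "nnf_tm One = TOne"
| "nnf_tm NOne = TScale (- 1) TOne"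
| "nnf_tm (Add A B) = TAdd (nnf_tm A) (nnf_tm B)"
| "nnf_tm (Scale r A) = TScale (real_of_posreal r) (nnf_tm A)"
| "nnf_tm (Join A B) = TJoin (nnf_tm A) (nnf_tm B)"
| "nnf_tm (Meet A B) = TMeet (nnf_tm A) (nnf_tm B)"
| "nnf_tm (Dia A) = TDia (nnf_tm A)"

text \<open>
  Sums and joins of a finite multiset of terms. To obtain a term, an enumeration of the
  multiset has to be chosen; by \<open>tm_sum_mset\<close> and \<open>tm_join_mset\<close> below, the choice does not
  matter up to derivable equality. The join of the empty multiset is a junk value.
\<close>

definition tm_sum :: "tm multiset \<Rightarrow> tm" where
  "tm_sum M = foldr TAdd (SOME ts. mset ts = M) TZero"

definition tm_join :: "tm multiset \<Rightarrow> tm" where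
  "tm_join M = (let ts = (SOME ts. mset ts = M) in foldr TJoin (tl ts) (hd ts))"

definition sequent_tm :: "sequent \<Rightarrow> tm" where
  "sequent_tm \<Gamma> = tm_sum (image_mset (\<lambda>(r, A). TScale (real_of_posreal r) (nnf_tm A)) \<Gamma>)"

definition hypersequent_tm :: "hypersequent \<Rightarrow> tm" where
  "hypersequent_tm G = tm_join (image_mset sequent_tm G)"

declare mrs_eq.trans [trans]

lemma foldr_move:
  assumes assoc: "\<And>a b c. f a (f b c) \<approx> f (f a b) c"
    and comm: "\<And>a b. f a b \<approx> f b a"
    and cong: "\<And>a a' b b'. a \<approx> a' \<Longrightarrow> b \<approx> b' \<Longrightarrow> f a b \<approx> f a' b'"
  shows "foldr f (ts @ t # us) z \<approx> f t (foldr f (ts @ us) z)"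
proof (induction ts)
  case Nil
  show ?case by (simp add: mrs_eq.refl)
next
  case (Cons a ts)
  let ?w = "foldr f (ts @ us) z"
  have "f a (foldr f (ts @ t # us) z) \<approx> f a (f t ?w)"
    by (intro cong mrs_eq.refl Cons)
  also have "f a (f t ?w) \<approx> f (f a t) ?w" by (rule assoc)
  also have "f (f a t) ?w \<approx> f (f t a) ?w" by (intro cong mrs_eq.refl comm)
  also have "f (f t a) ?w \<approx> f t (f a ?w)" by (rule mrs_eq.sym[OF assoc])
  finally show ?case by simp
qed

lemma foldr_mset:
  assumes assoc: "\<And>a b c. f a (f b c) \<approx> f (f a b) c"
    and comm: "\<And>a b. f a b \<approx> f b a"
    and cong: "\<And>a a' b b'. a \<approx> a' \<Longrightarrow> b \<approx> b' \<Longrightarrow> f a b \<approx> f a' b'"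
  shows "mset ts = mset us \<Longrightarrow> foldr f ts z \<approx> foldr f us z"
proof (induction ts arbitrary: us)
  case Nil
  then show ?case by (simp add: mrs_eq.refl)
next
  case (Cons t ts)
  have "t \<in> set us" using Cons.prems by (metis list.set_intros(1) set_mset_mset)
  then obtain vs ws where us: "us = vs @ t # ws" by (meson split_list)
  have "mset ts = mset (vs @ ws)" using Cons.prems us by simp
  then have "f t (foldr f ts z) \<approx> f t (foldr f (vs @ ws) z)"
    by (intro cong mrs_eq.refl Cons.IH)
  then show ?case
    using mrs_eq.trans mrs_eq.sym[OF foldr_move[OF assoc comm cong]] us
    by (metis comp_apply foldr.simps(2))
qed

lemma tm_sum_mset: "tm_sum (mset ts) \<approx> foldr TAdd ts TZero"
proof -
  have "mset (SOME us. mset us = mset ts) = mset ts" by (rule someI[of _ ts]) simp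
  then show ?thesis unfolding tm_sum_def
    by (rule foldr_mset[rotated 3]) (auto intro: mrs_eq.intros mrs_axiom.intros)
qed

lemma foldr_join_mset:
  assumes "mset (t # ts) = mset (u # us)"
  shows "foldr TJoin ts t \<approx> foldr TJoin us u"
proof -
  note comm = mrs_eq.ax[OF mrs_axiom.join_comm]
  note assoc = mrs_eq.ax[OF mrs_axiom.join_assoc]
  note cong = mrs_eq.cong_join
  have base: "foldr TJoin xs (TJoin a b) \<approx> TJoin a (foldr TJoin xs b)" for xs a b
    using foldr_move[of TJoin xs a "[]" b, OF assoc comm cong] by simp
  have init: "foldr TJoin xs (TJoin a b) \<approx> foldr TJoin xs (TJoin b a)" for xs a b
    by (induction xs) (simp_all add: comm cong mrs_eq.refl)
  show ?thesis
  proof (cases "t = u")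
    case True
    then show ?thesis using assms by (auto intro: foldr_mset[OF assoc comm cong])
  next
    case False
    then have "u \<in> set ts" using assms
      by (metis list.set_intros(1) set_ConsD set_mset_mset)
    then obtain vs ws where ts: "ts = vs @ u # ws" by (meson split_list)
    have us: "mset us = mset (t # vs @ ws)" using assms ts by simp
    have "foldr TJoin ts t \<approx> TJoin u (foldr TJoin (vs @ ws) t)"
      unfolding ts by (rule foldr_move[OF assoc comm cong])
    also have "TJoin u (foldr TJoin (vs @ ws) t) \<approx> foldr TJoin (vs @ ws) (TJoin u t)"
      by (rule mrs_eq.sym[OF base])
    also have "foldr TJoin (vs @ ws) (TJoin u t) \<approx> foldr TJoin (vs @ ws) (TJoin t u)"
      by (rule init)
    also have "foldr TJoin (vs @ ws) (TJoin t u) \<approx> foldr TJoin (t # vs @ ws) u"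
      using base[of "vs @ ws" t u] by simp
    also have "foldr TJoin (t # vs @ ws) u \<approx> foldr TJoin us u"
      by (rule foldr_mset[OF assoc comm cong us[symmetric]])
    finally show ?thesis .
  qed
qed

lemma tm_join_mset: "tm_join (mset (t # ts)) \<approx> foldr TJoin ts t"
proof -
  define us where "us = (SOME us. mset us = mset (t # ts))"
  have us: "mset us = mset (t # ts)" unfolding us_def by (rule someI[of _ "t # ts"]) simp
  then obtain v vs where "us = v # vs" by (cases us) auto
  then show ?thesis
    using us foldr_join_mset[of v vs t ts] unfolding tm_join_def us_def[symmetric] by simp
qed


section \<open>The hypersequent calculus HMR\<close>

text \<open>
  The context \<open>G\<close> may be the empty multiset, so that the displayed sequents form the whole
  hypersequent; \<open>Dia\<close> acts on single-sequent hypersequents only.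
\<close>

inductive HMR :: "hypersequent \<Rightarrow> bool" where
  INIT: "HMR {#{#}#}"
| W: "HMR G \<Longrightarrow> HMR (add_mset \<Gamma> G)"
| C: "HMR (add_mset \<Gamma> (add_mset \<Gamma> G)) \<Longrightarrow> HMR (add_mset \<Gamma> G)"
| S: "HMR (add_mset (\<Gamma>1 + \<Gamma>2) G) \<Longrightarrow> HMR (add_mset \<Gamma>1 (add_mset \<Gamma>2 G))"
| M: "HMR (add_mset \<Gamma>1 G) \<Longrightarrow> HMR (add_mset \<Gamma>2 G) \<Longrightarrow> HMR (add_mset (\<Gamma>1 + \<Gamma>2) G)"
| T: "HMR (add_mset (wscale r \<Gamma>) G) \<Longrightarrow> HMR (add_mset \<Gamma> G)"
| ID: "wsum rs = wsum ss \<Longrightarrow> HMR (add_mset \<Gamma> G) \<Longrightarrow>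
    HMR (add_mset (\<Gamma> + wvec rs (Var x) + wvec ss (NVar x)) G)"
| Zero: "HMR (add_mset \<Gamma> G) \<Longrightarrow> HMR (add_mset (\<Gamma> + wvec rs Zero) G)"
| Add: "HMR (add_mset (\<Gamma> + wvec rs A + wvec rs B) G) \<Longrightarrow>
    HMR (add_mset (\<Gamma> + wvec rs (Add A B)) G)"
| Scale: "HMR (add_mset (\<Gamma> + wvec (map ((*) s) rs) A) G) \<Longrightarrow>
    HMR (add_mset (\<Gamma> + wvec rs (Scale s A)) G)"
| Join: "HMR (add_mset (\<Gamma> + wvec rs A) (add_mset (\<Gamma> + wvec rs B) G)) \<Longrightarrow>
    HMR (add_mset (\<Gamma> + wvec rs (Join A B)) G)"
| Meet: "HMR (add_mset (\<Gamma> + wvec rs A) G) \<Longrightarrow> HMR (add_mset (\<Gamma> + wvec rs B) G) \<Longrightarrow>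
    HMR (add_mset (\<Gamma> + wvec rs (Meet A B)) G)"
| CAN: "wsum rs = wsum ss \<Longrightarrow> HMR (add_mset (\<Gamma> + wvec ss A + wvec rs (neg A)) G) \<Longrightarrow>
    HMR (add_mset \<Gamma> G)"
| One: "wsum rs \<ge> wsum ss \<Longrightarrow> HMR (add_mset \<Gamma> G) \<Longrightarrow>
    HMR (add_mset (\<Gamma> + wvec rs One + wvec ss NOne) G)"
| Dia: "wsum rs \<ge> wsum ss \<Longrightarrow> HMR {#\<Gamma> + wvec rs One + wvec ss NOne#} \<Longrightarrow>
    HMR {#wdia \<Gamma> + wvec rs One + wvec ss NOne#}"

end

theory Submission
  imports Defs
begin

text \<open>
  The rules of HMR make the formulas modulo provable equivalence into a modal Riesz space, with
  cancellation giving transitivity of the order. Equational logic is sound in this Lindenbaum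
  algebra, where nonnegativity of a formula means its derivability; the interpretation of a
  hypersequent is then taken apart again by cancelling against derivable sequents.
\<close>

section \<open>Admissible rules\<close>

instantiation posreal :: one
begin

definition one_posreal :: posreal where
  "1 = Posreal 1"

instance ..

end

instantiation posreal :: plus
begin

definition plus_posreal :: "posreal \<Rightarrow> posreal \<Rightarrow> posreal" where
  "r + s = Posreal (real_of_posreal r + real_of_posreal s)"

instance ..

end

lemma real_of_posreal_one [simp]: "real_of_posreal 1 = 1"
  by (simp add: one_posreal_def Posreal_inverse)

lemma real_of_posreal_plus [simp]: "real_of_posreal (r + s) = real_of_posreal r + real_of_posreal s"
  by (simp add: plus_posreal_def Posreal_inverse real_of_posreal_pos add_pos_pos)

lemmas [simp] = real_of_posreal_times

lemma real_of_posreal_Posreal: "r > 0 \<Longrightarrow> real_of_posreal (Posreal r) = r"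
  by (simp add: Posreal_inverse)

lemma posreal_mult_1 [simp]: "1 * r = (r :: posreal)" "r * 1 = (r :: posreal)"
  by (simp_all add: real_of_posreal_inject[symmetric])

lemma neg_neg [simp]: "neg (neg A) = A"
  by (induction A) auto

lemma wsum_simps [simp]: "wsum [] = 0" "wsum (r # rs) = real_of_posreal r + wsum rs"
  by (simp_all add: wsum_def)

lemma wvec_simps [simp]: "wvec [] A = {#}" "wvec (r # rs) A = add_mset (r, A) (wvec rs A)"
  by (simp_all add: wvec_def)

lemma wsum_map_times [simp]: "wsum (map ((*) s) rs) = real_of_posreal s * wsum rs"
  by (induction rs) (auto simp: algebra_simps)

lemma wdia_simps [simp]:
  "wdia {#} = {#}" "wdia (add_mset (r, A) \<Gamma>) = add_mset (r, Dia A) (wdia \<Gamma>)"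
  "wdia (\<Gamma> + \<Delta>) = wdia \<Gamma> + wdia \<Delta>"
  by (auto simp: wdia_def)

lemma wdia_wvec [simp]: "wdia (wvec rs A) = wvec rs (Dia A)"
  by (induction rs) auto

lemma wscale_simps [simp]:
  "wscale s {#} = {#}" "wscale s (add_mset (r, A) \<Gamma>) = add_mset (s * r, A) (wscale s \<Gamma>)"
  by (auto simp: wscale_def)

section \<open>Derived forms of the rules: mix, identity, cut\<close>

lemma HMR_weaken: "HMR G \<Longrightarrow> HMR (G + H)"
  by (induction H) (auto intro: HMR.W)

lemma HMR_mix:
  assumes "HMR {#\<Gamma>#}" "HMR (add_mset \<Delta> G)"
  shows "HMR (add_mset (\<Gamma> + \<Delta>) G)"
  using HMR.M[OF _ assms(2)] HMR_weaken[OF assms(1), of G] by simp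

text \<open>Induction on \<open>A\<close>. Only the sums of the weights have to agree, not the
  lists; this is what later makes \<open>(r + s) A\<close> comparable with
  \<open>r A + s A\<close>.\<close>

lemma HMR_identity_vec: "wsum rs = wsum ss \<Longrightarrow> HMR {#wvec rs A + wvec ss (neg A)#}"
proof (induction A arbitrary: rs ss)
  case (Var x)
  show ?case using HMR.ID[OF Var HMR.INIT] by simp
next
  case (NVar x)
  show ?case using HMR.ID[OF NVar[symmetric] HMR.INIT] by (simp add: ac_simps)
next
  case Zero
  show ?case using HMR.Zero[OF HMR.Zero[OF HMR.INIT]] by simp
next
  case One
  show ?case using HMR.One[OF _ HMR.INIT, of ss rs] One by simp
next
  case NOne
  show ?case using HMR.One[OF _ HMR.INIT, of rs ss] NOne by (simp add: ac_simps)
next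
  case (Add A B)
  have "HMR {#(wvec rs A + wvec ss (neg A)) + (wvec rs B + wvec ss (neg B))#}"
    by (intro HMR_mix Add)
  then have "HMR {#(wvec rs A + wvec rs B) + wvec ss (neg A) + wvec ss (neg B)#}"
    by (simp add: ac_simps)
  from HMR.Add[OF this] have "HMR {#wvec ss (Add (neg A) (neg B)) + wvec rs A + wvec rs B#}"
    by (simp add: ac_simps)
  from HMR.Add[OF this] show ?case by (simp add: ac_simps)
next
  case (Scale s A)
  have "HMR {#wvec (map ((*) s) rs) A + wvec (map ((*) s) ss) (neg A)#}"
    by (intro Scale) (simp add: Scale)
  from HMR.Scale[OF this]
  have "HMR {#wvec ss (Scale s (neg A)) + wvec (map ((*) s) rs) A#}"
    by (simp add: ac_simps)
  from HMR.Scale[OF this] show ?case by (simp add: ac_simps)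
next
  case (Join A B)
  \<comment> \<open>Whichever of \<open>A\<close> and \<open>B\<close> is \<open>C\<close>, one
    component is an identity on \<open>C\<close> and the other comes from weakening. So both
    premises of \<open>Meet\<close> for the negated join are available.\<close>
  have "HMR {#wvec ss (neg C) + wvec rs A, wvec ss (neg C) + wvec rs B#}" if "C = A \<or> C = B" for C
    using that HMR.W[OF Join.IH(1)[OF Join.prems], of "wvec ss (neg A) + wvec rs B"]
      HMR.W[OF Join.IH(2)[OF Join.prems], of "wvec ss (neg B) + wvec rs A"]
    by (auto simp: ac_simps add_mset_commute)
  from this[THEN HMR.Join]
  have "HMR {#wvec rs (Join A B) + wvec ss (neg A)#}" "HMR {#wvec rs (Join A B) + wvec ss (neg B)#}"
    by (simp_all add: ac_simps)
  from HMR.Meet[OF this] show ?case by simp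
next
  case (Meet A B)
  have "HMR {#wvec rs C + wvec ss (neg A), wvec rs C + wvec ss (neg B)#}" if "C = A \<or> C = B" for C
    using that HMR.W[OF Meet.IH(1)[OF Meet.prems], of "wvec rs A + wvec ss (neg B)"]
      HMR.W[OF Meet.IH(2)[OF Meet.prems], of "wvec rs B + wvec ss (neg A)"]
    by (auto simp: ac_simps add_mset_commute)
  from this[THEN HMR.Join]
  have "HMR {#wvec ss (neg (Meet A B)) + wvec rs A#}" "HMR {#wvec ss (neg (Meet A B)) + wvec rs B#}"
    by (simp_all add: ac_simps)
  from HMR.Meet[OF this] show ?case by (simp add: ac_simps)
next
  case (Dia A)
  \<comment> \<open>With empty vectors of \<open>One\<close> and \<open>NOne\<close>, the modal rule
    applies to the bare identity sequent.\<close>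
  show ?case using HMR.Dia[of "[]" "[]", simplified, OF Dia.IH[OF Dia.prems]] by simp
qed

lemma HMR_identity: "HMR {#{#(r, A), (r, neg A)#}#}"
  using HMR_identity_vec[of "[r]" "[r]" A] by (simp add: add_mset_commute)

lemma HMR_identity_add: "HMR (add_mset \<Gamma> G) \<Longrightarrow> HMR (add_mset (add_mset (r, A) (add_mset (r, neg A) \<Gamma>)) G)"
  using HMR_mix[OF HMR_identity[of r A], of \<Gamma> G] by simp

lemma HMR_Zero: "HMR (add_mset \<Gamma> G) \<Longrightarrow> HMR (add_mset (add_mset (r, Zero) \<Gamma>) G)"
  using HMR.Zero[of \<Gamma> G "[r]"] by simp

lemma HMR_Add:
  "HMR (add_mset (add_mset (r, A) (add_mset (r, B) \<Gamma>)) G) \<Longrightarrow> HMR (add_mset (add_mset (r, Add A B) \<Gamma>) G)"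
  using HMR.Add[of \<Gamma> "[r]" A B G] by (simp add: add_mset_commute)

lemma HMR_Scale:
  "HMR (add_mset (add_mset (s * r, A) \<Gamma>) G) \<Longrightarrow> HMR (add_mset (add_mset (r, Scale s A) \<Gamma>) G)"
  using HMR.Scale[of \<Gamma> s "[r]" A G] by simp

lemma HMR_Join:
  "HMR (add_mset (add_mset (r, A) \<Gamma>) (add_mset (add_mset (r, B) \<Gamma>) G)) \<Longrightarrow>
    HMR (add_mset (add_mset (r, Join A B) \<Gamma>) G)"
  using HMR.Join[of \<Gamma> "[r]" A B G] by simp

lemma HMR_Meet:
  "HMR (add_mset (add_mset (r, A) \<Gamma>) G) \<Longrightarrow> HMR (add_mset (add_mset (r, B) \<Gamma>) G) \<Longrightarrow>
    HMR (add_mset (add_mset (r, Meet A B) \<Gamma>) G)"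
  using HMR.Meet[of \<Gamma> "[r]" A G B] by simp

lemma HMR_Dia: "HMR {#\<Gamma>#} \<Longrightarrow> HMR {#wdia \<Gamma>#}"
  using HMR.Dia[of "[]" "[]" \<Gamma>] by simp

text \<open>Rule \<open>M\<close> brings \<open>A\<close> and \<open>neg A\<close> into one sequent,
  and \<open>CAN\<close> removes the pair.\<close>

lemma HMR_cut:
  assumes "HMR (add_mset (add_mset (r, A) \<Gamma>) G)" "HMR (add_mset (add_mset (r, neg A) \<Delta>) G)"
  shows "HMR (add_mset (\<Gamma> + \<Delta>) G)"
  using HMR.CAN[of "[r]" "[r]" "\<Gamma> + \<Delta>" A G] HMR.M[OF assms] by (simp add: add_mset_commute)

lemma HMR_cut_single:
  assumes "HMR (add_mset (add_mset (r, A) \<Gamma>) G)" "HMR {#add_mset (r, neg A) \<Delta>#}"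
  shows "HMR (add_mset (\<Gamma> + \<Delta>) G)"
  using HMR_cut[OF assms(1), of \<Delta>] HMR_weaken[OF assms(2), of G] by simp

text \<open>With \<open>J\<close> the negation of the join, the hypersequent with components
  \<open>J, A\<close> and \<open>J, B\<close> is derivable. Cutting the join against each component
  leaves \<open>A\<close> and \<open>B\<close>.\<close>

lemma HMR_Join_inverse:
  assumes "HMR (add_mset (add_mset (r, Join A B) {#}) G)"
  shows "HMR (add_mset {#(r, A)#} (add_mset {#(r, B)#} G))"
proof -
  let ?J = "Meet (neg A) (neg B)"
  have AA: "HMR {#{#(r, neg A), (r, A)#}#}" and BB: "HMR {#{#(r, neg B), (r, B)#}#}"
    using HMR_identity by (simp_all add: add_mset_commute)
  \<comment> \<open>The crossed case is the only one without an identity component: the sum of two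
    identities is regrouped so that \<open>S\<close> splits it crosswise.\<close>
  have "HMR {#{#(r, neg B), (r, A)#} + {#(r, neg A), (r, B)#}#}"
    using HMR_mix[OF AA BB] by (simp add: add_mset_commute)
  from HMR.S[of _ _ "{#}", OF this]
  have AB: "HMR {#{#(r, neg B), (r, A)#}, {#(r, neg A), (r, B)#}#}" .
  \<comment> \<open>\<open>Meet\<close> introduces \<open>J\<close> first in the component of
    \<open>A\<close>, then in that of \<open>B\<close>; every remaining premise contains an identity
    and follows by weakening.\<close>
  have "HMR {#{#(r, ?J), (r, A)#}, {#(r, neg A), (r, B)#}#}"
    using HMR.W[OF AA, of "{#(r, neg A), (r, B)#}"] AB by (intro HMR_Meet) (simp_all add: add_mset_commute)
  moreover have "HMR {#{#(r, ?J), (r, A)#}, {#(r, neg B), (r, B)#}#}"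
    using HMR.W[OF BB, of "{#(r, ?J), (r, A)#}"] by (simp add: add_mset_commute)
  ultimately have "HMR {#{#(r, ?J), (r, B)#}, {#(r, ?J), (r, A)#}#}"
    by (intro HMR_Meet) (simp_all add: add_mset_commute)
  then have 1: "HMR (add_mset {#(r, ?J), (r, B)#} (add_mset {#(r, ?J), (r, A)#} G))"
    using HMR_weaken by fastforce
  \<comment> \<open>The assumption is used twice, once for each component; weakening supplies the
    context that the other premise of each cut carries.\<close>
  have "HMR (add_mset {#(r, Join A B)#} (add_mset {#(r, ?J), (r, A)#} G))"
    using HMR.W[OF assms, of "{#(r, ?J), (r, A)#}"] by (simp add: add_mset_commute)
  from HMR_cut[OF this, of "{#(r, B)#}"] 1
  have "HMR (add_mset {#(r, ?J), (r, A)#} (add_mset {#(r, B)#} G))"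
    by (simp add: add_mset_commute)
  moreover have "HMR (add_mset {#(r, Join A B)#} (add_mset {#(r, B)#} G))"
    using HMR.W[OF assms] by (simp add: add_mset_commute)
  ultimately show ?thesis
    using HMR_cut[of r "Join A B" "{#}" "add_mset {#(r, B)#} G" "{#(r, A)#}"] by simp
qed


section \<open>The Lindenbaum algebra\<close>

text \<open>The sequent is the formal counterpart of \<open>0 \<le> B - A\<close>.\<close>

definition nnf_le :: "nnf \<Rightarrow> nnf \<Rightarrow> bool" where
  "nnf_le A B \<longleftrightarrow> HMR {#{#(1, neg A), (1, B)#}#}"

lemma nnf_le_refl: "nnf_le A A"
  using HMR_identity[of 1 A] by (simp add: nnf_le_def add_mset_commute)

lemma nnf_le_trans: "nnf_le A B \<Longrightarrow> nnf_le B C \<Longrightarrow> nnf_le A C"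
  using HMR_cut[of 1 B "{#(1, neg A)#}" "{#}" "{#(1, C)#}"]
  by (simp add: nnf_le_def add_mset_commute)

text \<open>As \<open>neg\<close> is an involution, both sides speak of the same two-element
  multiset.\<close>

lemma nnf_le_neg: "nnf_le (neg A) (neg B) \<longleftrightarrow> nnf_le B A"
  by (simp add: nnf_le_def add_mset_commute)

section \<open>Laws of modal Riesz spaces as derivable sequents\<close>

lemma nnf_le_Add_left: "nnf_le A B \<Longrightarrow> nnf_le (Add C A) (Add C B)"
proof -
  assume "nnf_le A B"
  then have "HMR {#{#(1, neg C), (1, C)#} + {#(1, neg A), (1, B)#}#}"
    using nnf_le_refl[of C] by (intro HMR_mix) (simp_all add: nnf_le_def)
  then have "HMR {#{#(1, C), (1, B), (1, neg C), (1, neg A)#}#}"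
    by (simp add: add_mset_commute)
  from HMR_Add[OF this] have "HMR {#{#(1, neg C), (1, neg A), (1, Add C B)#}#}"
    by (simp add: add_mset_commute)
  from HMR_Add[OF this] show ?thesis by (simp add: nnf_le_def)
qed

lemma nnf_le_Add_commute: "nnf_le (Add A B) (Add B A)"
proof -
  have "HMR {#{#(1, B), (1, neg B), (1, A), (1, neg A)#}#}"
    by (intro HMR_identity_add HMR_identity)
  then have "HMR {#{#(1, B), (1, A), (1, neg A), (1, neg B)#}#}"
    by (simp add: add_mset_commute)
  from HMR_Add[OF this] have "HMR {#{#(1, neg A), (1, neg B), (1, Add B A)#}#}"
    by (simp add: add_mset_commute)
  from HMR_Add[OF this] show ?thesis by (simp add: nnf_le_def)
qed

text \<open>One identity per summand is mixed into a single sequent; the sums are then introduced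
  from the inside out. Reordering is free in a multiset, so the bracketing leaves no trace in the
  leaves. The other linear laws follow the same pattern.\<close>

lemma nnf_le_Add_assoc: "nnf_le (Add (Add A B) C) (Add A (Add B C))"
proof -
  have "HMR {#{#(1, A), (1, neg A), (1, B), (1, neg B), (1, C), (1, neg C)#}#}"
    by (intro HMR_identity_add HMR_identity)
  then have "HMR {#{#(1, B), (1, C), (1, A), (1, neg A), (1, neg B), (1, neg C)#}#}"
    by (simp add: add_mset_commute)
  from HMR_Add[OF this] have "HMR {#{#(1, A), (1, Add B C), (1, neg A), (1, neg B), (1, neg C)#}#}"
    by (simp add: add_mset_commute)
  from HMR_Add[OF this] have "HMR {#{#(1, neg A), (1, neg B), (1, neg C), (1, Add A (Add B C))#}#}"
    by (simp add: add_mset_commute)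
  from HMR_Add[OF this] have "HMR {#{#(1, Add (neg A) (neg B)), (1, neg C), (1, Add A (Add B C))#}#}" .
  from HMR_Add[OF this] show ?thesis by (simp add: nnf_le_def)
qed

lemma nnf_le_Zero_Add: "nnf_le (Add Zero A) A"
  unfolding nnf_le_def neg.simps by (intro HMR_Add HMR_Zero nnf_le_refl[unfolded nnf_le_def])

lemma nnf_le_Add_neg: "nnf_le (Add (neg A) A) Zero"
proof -
  have "HMR {#{#(1, Zero), (1, A), (1, neg A)#}#}"
    by (intro HMR_Zero HMR_identity)
  then have "HMR {#{#(1, A), (1, neg A), (1, Zero)#}#}" by (simp add: add_mset_commute)
  from HMR_Add[OF this] show ?thesis by (simp add: nnf_le_def)
qed

lemma nnf_le_Scale: "nnf_le A B \<Longrightarrow> nnf_le (Scale r A) (Scale r B)"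
proof -
  assume "nnf_le A B"
  \<comment> \<open>Multiplying the sequent with weights \<open>r\<close> by the inverse of
    \<open>r\<close> gives the assumed sequent with weights 1, so rule \<open>T\<close>
    applies.\<close>
  moreover define s where "s = Posreal (1 / real_of_posreal r)"
  then have "s * r = 1"
    by (simp add: real_of_posreal_inject[symmetric] real_of_posreal_Posreal real_of_posreal_pos
        less_imp_neq[OF real_of_posreal_pos, symmetric])
  ultimately have "HMR {#{#(r, neg A), (r, B)#}#}"
    using HMR.T[of s "{#(r, neg A), (r, B)#}" "{#}"] by (simp add: nnf_le_def)
  then have "HMR {#{#(1, Scale r B), (r, neg A)#}#}"
    by (intro HMR_Scale) (simp add: add_mset_commute)
  then have "HMR {#{#(1, Scale r (neg A)), (1, Scale r B)#}#}"
    by (intro HMR_Scale) (simp add: add_mset_commute)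
  then show ?thesis by (simp add: nnf_le_def)
qed

lemma nnf_le_Scale_Add: "nnf_le (Scale r (Add A B)) (Add (Scale r A) (Scale r B))"
proof -
  have "HMR {#{#(r, A), (r, neg A), (r, B), (r, neg B)#}#}"
    by (intro HMR_identity_add HMR_identity)
  then have "HMR {#{#(r * 1, neg A), (r * 1, neg B), (r * 1, A), (r * 1, B)#}#}"
    by (simp add: add_mset_commute)
  from HMR_Scale[OF HMR_Add[OF this]]
  have "HMR {#{#(r * 1, A), (r * 1, B), (1, Scale r (Add (neg A) (neg B)))#}#}"
    by (simp add: add_mset_commute)
  from HMR_Scale[OF this]
  have "HMR {#{#(r * 1, B), (1, Scale r A), (1, Scale r (Add (neg A) (neg B)))#}#}"
    by (simp add: add_mset_commute)
  from HMR_Scale[OF this]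
  have "HMR {#{#(1, Scale r A), (1, Scale r B), (1, Scale r (Add (neg A) (neg B)))#}#}"
    by (simp add: add_mset_commute)
  from HMR_Add[OF this] show ?thesis by (simp add: nnf_le_def add_mset_commute)
qed

lemma nnf_le_Scale_plus: "nnf_le (Scale (r + s) A) (Add (Scale r A) (Scale s A))"
proof -
  \<comment> \<open>The identity for two different weight lists of equal sum; the factor 1 prepares
    the weight for \<open>HMR_Scale\<close>.\<close>
  have "HMR {#{#((r + s) * 1, neg A), (r, A), (s, A)#}#}"
    using HMR_identity_vec[of "[r, s]" "[r + s]" A] by (simp add: add_mset_commute)
  from HMR_Scale[OF this] have "HMR {#{#(r * 1, A), (s, A), (1, Scale (r + s) (neg A))#}#}"
    by (simp add: add_mset_commute)
  from HMR_Scale[OF this] have "HMR {#{#(s * 1, A), (1, Scale r A), (1, Scale (r + s) (neg A))#}#}"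
    by (simp add: add_mset_commute)
  from HMR_Scale[OF this] have "HMR {#{#(1, Scale r A), (1, Scale s A), (1, Scale (r + s) (neg A))#}#}"
    by (simp add: add_mset_commute)
  from HMR_Add[OF this] show ?thesis by (simp add: nnf_le_def add_mset_commute)
qed

lemma nnf_le_Scale_Scale: "nnf_le (Scale r (Scale s A)) (Scale (r * s) A)"
proof -
  have "s * r = r * s" by (simp add: real_of_posreal_inject[symmetric])
  then have "HMR {#{#(s * (r * 1), neg A), ((r * s) * 1, A)#}#}"
    using HMR_identity[of "r * s" A] by (simp add: add_mset_commute)
  from HMR_Scale[OF HMR_Scale[OF this]] have "HMR {#{#((r * s) * 1, A), (1, Scale r (Scale s (neg A)))#}#}"
    by (simp add: add_mset_commute)
  from HMR_Scale[OF this] show ?thesis by (simp add: nnf_le_def add_mset_commute)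
qed

lemma nnf_le_Scale_1: "nnf_le (Scale 1 A) A"
  using HMR_Scale[of 1 1 "neg A" "{#(1, A)#}" "{#}"] nnf_le_refl[of A] by (simp add: nnf_le_def)

text \<open>The negated meet is a join, whose rule asks for two components: one is an identity, the
  other is added by weakening.\<close>

lemma nnf_le_Meet1: "nnf_le (Meet A B) A"
  using HMR_Join[of 1 "neg A" "{#(1, A)#}" "neg B" "{#}"]
    HMR.W[OF nnf_le_refl[of A, unfolded nnf_le_def], of "{#(1, neg B), (1, A)#}"]
  by (simp add: nnf_le_def add_mset_commute)

lemma nnf_le_Meet2: "nnf_le (Meet A B) B"
  using HMR_Join[of 1 "neg A" "{#(1, B)#}" "neg B" "{#}"]
    HMR.W[OF nnf_le_refl[of B, unfolded nnf_le_def], of "{#(1, neg A), (1, B)#}"]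
  by (simp add: nnf_le_def add_mset_commute)

lemma nnf_le_MeetI: "nnf_le C A \<Longrightarrow> nnf_le C B \<Longrightarrow> nnf_le C (Meet A B)"
  using HMR_Meet[of 1 A "{#(1, neg C)#}" "{#}" B] by (simp add: nnf_le_def add_mset_commute)

text \<open>De Morgan dual of the law for meets, by antitonicity of \<open>neg\<close>.\<close>

lemma nnf_le_Join1: "nnf_le A (Join A B)"
  using nnf_le_Meet1[of "neg A" "neg B"] nnf_le_neg[of "Join A B" A] by simp

lemma nnf_le_Join2: "nnf_le B (Join A B)"
  using nnf_le_Meet2[of "neg A" "neg B"] nnf_le_neg[of "Join A B" B] by simp

lemma nnf_le_JoinI: "nnf_le A C \<Longrightarrow> nnf_le B C \<Longrightarrow> nnf_le (Join A B) C"
  using nnf_le_MeetI[of "neg C" "neg A" "neg B"] nnf_le_neg[of C "Join A B"] by (simp add: nnf_le_neg)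

text \<open>The order is expressed by a single-sequent hypersequent, the only shape that the modal
  rule accepts.\<close>

lemma nnf_le_Dia: "nnf_le A B \<Longrightarrow> nnf_le (Dia A) (Dia B)"
  using HMR_Dia[of "{#(1, neg A), (1, B)#}"] by (simp add: nnf_le_def)

lemma nnf_le_Dia_Add: "nnf_le (Dia (Add A B)) (Add (Dia A) (Dia B))"
proof -
  have "HMR {#{#(1, A), (1, neg A), (1, B), (1, neg B)#}#}"
    by (intro HMR_identity_add HMR_identity)
  then have "HMR {#{#(1, neg A), (1, neg B), (1, A), (1, B)#}#}"
    by (simp add: add_mset_commute)
  from HMR_Dia[OF HMR_Add[OF this]]
  have "HMR {#{#(1, Dia A), (1, Dia B), (1, Dia (Add (neg A) (neg B)))#}#}"
    by (simp add: add_mset_commute)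
  from HMR_Add[OF this] show ?thesis by (simp add: nnf_le_def add_mset_commute)
qed

lemma nnf_le_Dia_Scale: "nnf_le (Dia (Scale r A)) (Scale r (Dia A))"
proof -
  have "HMR {#{#(r * 1, neg A), (r, A)#}#}"
    using HMR_identity[of r A] by (simp add: add_mset_commute)
  from HMR_Dia[OF HMR_Scale[OF this]] have "HMR {#{#(r * 1, Dia A), (1, Dia (Scale r (neg A)))#}#}"
    by (simp add: add_mset_commute)
  from HMR_Scale[OF this] show ?thesis by (simp add: nnf_le_def add_mset_commute)
qed

lemma nnf_le_Zero_One: "nnf_le Zero One"
  using HMR_Zero[OF HMR.One[OF _ HMR.INIT, of "[]" "[1]"]] by (simp add: nnf_le_def)

lemma nnf_le_Dia_One: "nnf_le (Dia One) One"
proof -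
  \<comment> \<open>The identity on \<open>One\<close> is split unevenly: \<open>NOne\<close> counts
    as context and receives \<open>Dia\<close>, while \<open>One\<close> stays in the displayed
    vector and remains unprefixed.\<close>
  have "HMR {#{#(1, NOne)#} + wvec [1] One + wvec [] NOne#}"
    using nnf_le_refl[of One] by (simp add: nnf_le_def add_mset_commute)
  from HMR.Dia[OF _ this] show ?thesis by (simp add: nnf_le_def add_mset_commute)
qed

section \<open>The quotient as a lattice-ordered group\<close>

definition nnf_equiv :: "nnf \<Rightarrow> nnf \<Rightarrow> bool" where
  "nnf_equiv A B \<longleftrightarrow> nnf_le A B \<and> nnf_le B A"

text \<open>Negation commutes with the linear operations and with \<open>Dia\<close>, so for an equation between these
  the second premise is an instance of the same inequality as the first.\<close>

lemma nnf_equiv_by_neg: "nnf_le A B \<Longrightarrow> nnf_le (neg A) (neg B) \<Longrightarrow> nnf_equiv A B"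
  by (simp add: nnf_equiv_def nnf_le_neg)

quotient_type lindenbaum = nnf / nnf_equiv
  by (rule equivpI) (auto simp: nnf_equiv_def reflp_def symp_def transp_def
      intro: nnf_le_refl nnf_le_trans)

lemma nnf_le_Add: "nnf_le A A' \<Longrightarrow> nnf_le B B' \<Longrightarrow> nnf_le (Add A B) (Add A' B')"
  by (meson nnf_le_Add_left nnf_le_Add_commute nnf_le_trans)

lemma nnf_le_Meet: "nnf_le A A' \<Longrightarrow> nnf_le B B' \<Longrightarrow> nnf_le (Meet A B) (Meet A' B')"
  by (meson nnf_le_MeetI nnf_le_Meet1 nnf_le_Meet2 nnf_le_trans)

lemma nnf_le_Join: "nnf_le A A' \<Longrightarrow> nnf_le B B' \<Longrightarrow> nnf_le (Join A B) (Join A' B')"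
  by (meson nnf_le_JoinI nnf_le_Join1 nnf_le_Join2 nnf_le_trans)

instantiation lindenbaum :: lattice
begin

lift_definition less_eq_lindenbaum :: "lindenbaum \<Rightarrow> lindenbaum \<Rightarrow> bool" is nnf_le
  by (auto simp: nnf_equiv_def intro: nnf_le_trans)

definition less_lindenbaum :: "lindenbaum \<Rightarrow> lindenbaum \<Rightarrow> bool" where
  "a < b \<longleftrightarrow> a \<le> b \<and> \<not> b \<le> (a :: lindenbaum)"

lift_definition inf_lindenbaum :: "lindenbaum \<Rightarrow> lindenbaum \<Rightarrow> lindenbaum" is Meet
  by (auto simp: nnf_equiv_def intro: nnf_le_Meet)

lift_definition sup_lindenbaum :: "lindenbaum \<Rightarrow> lindenbaum \<Rightarrow> lindenbaum" is Join
  by (auto simp: nnf_equiv_def intro: nnf_le_Join)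

instance
proof
  fix a b c :: lindenbaum
  show "a < b \<longleftrightarrow> a \<le> b \<and> \<not> b \<le> a" by (rule less_lindenbaum_def)
  show "a \<le> a" by transfer (rule nnf_le_refl)
  show "a \<le> b \<Longrightarrow> b \<le> c \<Longrightarrow> a \<le> c" by transfer (rule nnf_le_trans)
  show "a \<le> b \<Longrightarrow> b \<le> a \<Longrightarrow> a = b" by transfer (simp add: nnf_equiv_def)
  show "inf a b \<le> a" by transfer (rule nnf_le_Meet1)
  show "inf a b \<le> b" by transfer (rule nnf_le_Meet2)
  show "a \<le> b \<Longrightarrow> a \<le> c \<Longrightarrow> a \<le> inf b c" by transfer (rule nnf_le_MeetI)
  show "a \<le> sup a b" by transfer (rule nnf_le_Join1)
  show "b \<le> sup a b" by transfer (rule nnf_le_Join2)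
  show "b \<le> a \<Longrightarrow> c \<le> a \<Longrightarrow> sup b c \<le> a" by transfer (rule nnf_le_JoinI)
qed

end

instantiation lindenbaum :: ordered_ab_group_add
begin

lift_definition zero_lindenbaum :: lindenbaum is Zero .

lift_definition plus_lindenbaum :: "lindenbaum \<Rightarrow> lindenbaum \<Rightarrow> lindenbaum" is Add
  by (auto simp: nnf_equiv_def intro: nnf_le_Add)

lift_definition uminus_lindenbaum :: "lindenbaum \<Rightarrow> lindenbaum" is neg
  by (auto simp: nnf_equiv_def nnf_le_neg)

definition minus_lindenbaum :: "lindenbaum \<Rightarrow> lindenbaum \<Rightarrow> lindenbaum" where
  "a - b = a + - (b :: lindenbaum)"

instance
proof
  fix a b c :: lindenbaum
  show "a + b + c = a + (b + c)"
    by transfer (rule nnf_equiv_by_neg, use nnf_le_Add_assoc in auto)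
  show "a + b = b + a"
    by transfer (simp add: nnf_equiv_def nnf_le_Add_commute)
  show "0 + a = a"
    by transfer (rule nnf_equiv_by_neg, use nnf_le_Zero_Add in auto)
  \<comment> \<open>The negation of \<open>Add (neg A) A\<close> is \<open>Add A (neg A)\<close>,
    which is the same law for \<open>neg A\<close>.\<close>
  show "- a + a = 0"
    by transfer (rule nnf_equiv_by_neg, use nnf_le_Add_neg nnf_le_Add_neg[of "neg A" for A] in auto)
  show "a - b = a + - b" by (rule minus_lindenbaum_def)
  show "a \<le> b \<Longrightarrow> c + a \<le> c + b" by transfer (rule nnf_le_Add_left)
qed

end

section \<open>Scalar multiplication by arbitrary reals\<close>

lift_definition lindenbaum_scale :: "posreal \<Rightarrow> lindenbaum \<Rightarrow> lindenbaum" is Scale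
  by (auto simp: nnf_equiv_def intro: nnf_le_Scale)

lemma lindenbaum_scale_simps:
  "lindenbaum_scale r (a + b) = lindenbaum_scale r a + lindenbaum_scale r b"
  "lindenbaum_scale (r + s) a = lindenbaum_scale r a + lindenbaum_scale s a"
  "lindenbaum_scale r (lindenbaum_scale s a) = lindenbaum_scale (r * s) a"
  "lindenbaum_scale 1 a = a"
  by (transfer, rule nnf_equiv_by_neg,
      use nnf_le_Scale_Add nnf_le_Scale_plus nnf_le_Scale_Scale nnf_le_Scale_1 in auto)+

text \<open>Both sides have the same representative, because \<open>neg\<close> passes through
  \<open>Scale\<close> by definition.\<close>

lemma lindenbaum_scale_minus: "lindenbaum_scale r (- a) = - lindenbaum_scale r a"
  by transfer (simp add: nnf_equiv_def nnf_le_refl)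

lemma lindenbaum_scale_mono: "a \<le> b \<Longrightarrow> lindenbaum_scale r a \<le> lindenbaum_scale r b"
  by transfer (rule nnf_le_Scale)

lemma lindenbaum_scale_zero: "lindenbaum_scale r 0 = 0"
  using lindenbaum_scale_simps(1)[of r 0 0] by simp

lemma lindenbaum_scale_Posreal_plus:
  "r > 0 \<Longrightarrow> s > 0 \<Longrightarrow>
    lindenbaum_scale (Posreal (r + s)) a = lindenbaum_scale (Posreal r) a + lindenbaum_scale (Posreal s) a"
  by (simp add: lindenbaum_scale_simps(2)[symmetric] plus_posreal_def Posreal_inverse)

lemma lindenbaum_scale_Posreal_times:
  "r > 0 \<Longrightarrow> s > 0 \<Longrightarrow>
    lindenbaum_scale (Posreal (r * s)) a = lindenbaum_scale (Posreal r) (lindenbaum_scale (Posreal s) a)"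
  by (simp add: lindenbaum_scale_simps times_posreal_def Posreal_inverse)

instantiation lindenbaum :: ordered_real_vector
begin

text \<open>The syntax offers positive scalars only; the remaining cases are dictated by
  linearity.\<close>

definition scaleR_lindenbaum :: "real \<Rightarrow> lindenbaum \<Rightarrow> lindenbaum" where
  "r *\<^sub>R a = (if r > 0 then lindenbaum_scale (Posreal r) a
     else if r = 0 then 0 else - lindenbaum_scale (Posreal (- r)) a)"

instance
proof
  fix r s :: real and a b :: lindenbaum
  have pos: "(r + s) *\<^sub>R a = r *\<^sub>R a + s *\<^sub>R a" if "r > 0" "s > 0" for r s
    using that by (simp add: scaleR_lindenbaum_def lindenbaum_scale_Posreal_plus)
  have minus: "(- r) *\<^sub>R a = - (r *\<^sub>R a)" for r
    by (simp add: scaleR_lindenbaum_def)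
  \<comment> \<open>For scalars of opposite sign: the larger of \<open>r\<close> and
    \<open>s\<close> is the smaller plus a positive remainder, so \<open>pos\<close> applies and the
    terms are rearranged.\<close>
  have diff: "(r - s) *\<^sub>R a = r *\<^sub>R a - s *\<^sub>R a" if "r > 0" "s > 0" for r s
  proof (cases r s rule: linorder_cases)
    case less
    then show ?thesis using pos[of r "s - r"] minus[of "s - r"] that by (simp add: algebra_simps)
  next
    case greater
    then show ?thesis using pos[of s "r - s"] that by (simp add: algebra_simps)
  qed (simp add: scaleR_lindenbaum_def)
  show add: "(r + s) *\<^sub>R a = r *\<^sub>R a + s *\<^sub>R a" for r s
  proof -
    consider "r = 0" | "s = 0" | "r > 0" "s > 0" | "r > 0" "s < 0" | "r < 0" "s > 0" | "r < 0" "s < 0"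
      by linarith
    then show ?thesis
    proof cases
      case 3
      then show ?thesis by (rule pos)
    next
      case 4
      then show ?thesis using diff[of r "- s"] minus[of s] by simp
    next
      case 5
      then show ?thesis using diff[of s "- r"] minus[of r] by (simp add: add.commute)
    next
      case 6
      then show ?thesis using pos[of "- r" "- s"] minus[of r] minus[of s] minus[of "r + s"]
        by (simp add: algebra_simps)
    qed (simp_all add: scaleR_lindenbaum_def)
  qed
  show "r *\<^sub>R (a + b) = r *\<^sub>R a + r *\<^sub>R b"
    by (simp add: scaleR_lindenbaum_def lindenbaum_scale_simps)
  show "r *\<^sub>R s *\<^sub>R a = (r * s) *\<^sub>R a"
    \<comment> \<open>The four instances are the four combinations of nonzero signs, each stated for
      the absolute values.\<close>
    using lindenbaum_scale_Posreal_times[of r s a] lindenbaum_scale_Posreal_times[of r "- s" a]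
      lindenbaum_scale_Posreal_times[of "- r" s a] lindenbaum_scale_Posreal_times[of "- r" "- s" a]
    by (cases r "0 :: real" rule: linorder_cases; cases s "0 :: real" rule: linorder_cases)
      (simp_all add: scaleR_lindenbaum_def lindenbaum_scale_minus lindenbaum_scale_zero
        zero_less_mult_iff mult_less_0_iff)
  show "1 *\<^sub>R a = a"
    by (simp add: scaleR_lindenbaum_def lindenbaum_scale_simps one_posreal_def[symmetric])
  show mono: "r *\<^sub>R a \<le> r *\<^sub>R b" if "a \<le> b" "0 \<le> r" for r :: real and a b :: lindenbaum
    using that by (simp add: scaleR_lindenbaum_def lindenbaum_scale_mono)
  show "r *\<^sub>R a \<le> s *\<^sub>R a" if "r \<le> s" "0 \<le> a"
    \<comment> \<open>The difference of the two sides is \<open>(s - r) a\<close>, which is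
      nonnegative by \<open>mono\<close>.\<close>
    using add[of r "s - r"] mono[of 0 a "s - r"] that
    by (simp add: scaleR_lindenbaum_def lindenbaum_scale_zero split: if_splits)
qed

end

section \<open>The unit and the modality on the quotient\<close>

lift_definition lindenbaum_one :: lindenbaum is One .

lift_definition lindenbaum_dia :: "lindenbaum \<Rightarrow> lindenbaum" is Dia
  by (auto simp: nnf_equiv_def intro: nnf_le_Dia)

lemma lindenbaum_dia_add: "lindenbaum_dia (a + b) = lindenbaum_dia a + lindenbaum_dia b"
  by transfer (rule nnf_equiv_by_neg, use nnf_le_Dia_Add in auto)

lemma lindenbaum_dia_minus: "lindenbaum_dia (- a) = - lindenbaum_dia a"
  by transfer (simp add: nnf_equiv_def nnf_le_refl)

lemma lindenbaum_dia_zero: "lindenbaum_dia 0 = 0"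
  using lindenbaum_dia_add[of 0 0] by simp

lemma lindenbaum_dia_scale: "lindenbaum_dia (lindenbaum_scale r a) = lindenbaum_scale r (lindenbaum_dia a)"
  by transfer (rule nnf_equiv_by_neg, use nnf_le_Dia_Scale in auto)

lemma lindenbaum_dia_scaleR: "lindenbaum_dia (r *\<^sub>R a) = r *\<^sub>R lindenbaum_dia a"
  by (simp add: scaleR_lindenbaum_def lindenbaum_dia_scale lindenbaum_dia_minus lindenbaum_dia_zero)

lemma lindenbaum_dia_mono: "a \<le> b \<Longrightarrow> lindenbaum_dia a \<le> lindenbaum_dia b"
  by transfer (rule nnf_le_Dia)

lemma lindenbaum_zero_le_one: "0 \<le> lindenbaum_one"
  by transfer (rule nnf_le_Zero_One)

lemma lindenbaum_dia_one_le: "lindenbaum_dia lindenbaum_one \<le> lindenbaum_one"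
  by transfer (rule nnf_le_Dia_One)


section \<open>Completeness\<close>

lift_definition nnf_class :: "nnf \<Rightarrow> lindenbaum" is "\<lambda>A. A" .

section \<open>Evaluation of terms and soundness of equational logic\<close>

lemma nnf_class_simps:
  "nnf_class (NVar x) = - nnf_class (Var x)"
  "nnf_class Zero = 0"
  "nnf_class One = lindenbaum_one"
  "nnf_class NOne = - lindenbaum_one"
  "nnf_class (Add A B) = nnf_class A + nnf_class B"
  "nnf_class (Scale r A) = lindenbaum_scale r (nnf_class A)"
  "nnf_class (Join A B) = sup (nnf_class A) (nnf_class B)"
  "nnf_class (Meet A B) = inf (nnf_class A) (nnf_class B)"
  "nnf_class (Dia A) = lindenbaum_dia (nnf_class A)"
  by (transfer, simp add: nnf_equiv_def nnf_le_refl)+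

text \<open>Evaluation under the canonical assignment, which sends each variable to its own
  class.\<close>

primrec tm_class :: "tm \<Rightarrow> lindenbaum" where
  "tm_class (TVar x) = nnf_class (Var x)"
| "tm_class TZero = 0"
| "tm_class TOne = lindenbaum_one"
| "tm_class (TAdd a b) = tm_class a + tm_class b"
| "tm_class (TScale r a) = r *\<^sub>R tm_class a"
| "tm_class (TJoin a b) = sup (tm_class a) (tm_class b)"
| "tm_class (TMeet a b) = inf (tm_class a) (tm_class b)"
| "tm_class (TDia a) = lindenbaum_dia (tm_class a)"

lemma tm_class_axiom: "mrs_axiom a b \<Longrightarrow> tm_class a = tm_class b"
proof (induction rule: mrs_axiom.induct)
  case (dia_pos a)
  \<comment> \<open>Positivity of the modality is monotonicity combined with
    \<open>lindenbaum_dia 0 = 0\<close>.\<close>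
  show ?case using lindenbaum_dia_mono[of 0 "sup 0 (tm_class a)"]
    by (simp add: lindenbaum_dia_zero inf_absorb1)
next
  case (add_mono a b c)
  show ?case by (simp add: inf_absorb1)
next
  case (scale_mono r a b)
  then show ?case by (simp add: inf_absorb1 scaleR_left_mono)
qed (simp_all add: algebra_simps inf_absorb1 inf_absorb2 lindenbaum_zero_le_one lindenbaum_dia_one_le
    lindenbaum_dia_add lindenbaum_dia_scaleR inf_aci sup_aci inf_sup_absorb sup_inf_absorb)

lemma tm_class_eq: "a \<approx> b \<Longrightarrow> tm_class a = tm_class b"
  by (induction rule: mrs_eq.induct) (simp_all add: tm_class_axiom)

text \<open>The usual truth lemma of a canonical model: every formula evaluates to its own class.
  Only \<open>Scale\<close> needs an argument, because its weight becomes a real scalar in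
  \<open>tm\<close>.\<close>

lemma tm_class_nnf_tm: "tm_class (nnf_tm A) = nnf_class A"
proof (induction A)
  case (Scale r A)
  have "tm_class (nnf_tm (Scale r A)) = lindenbaum_scale r (nnf_class A)"
    by (simp add: Scale scaleR_lindenbaum_def real_of_posreal_pos real_of_posreal_inverse)
  then show ?case by (simp add: nnf_class_simps)
qed (simp_all add: nnf_class_simps)

section \<open>From nonnegative classes back to hypersequents\<close>

lemma HMR_of_nonneg:
  assumes "0 \<le> nnf_class A"
  shows "HMR {#{#(1, A)#}#}"
proof -
  have "HMR {#{#(1, Zero), (1, A)#}#}" using assms by transfer (simp add: nnf_le_def)
  \<comment> \<open>\<open>Zero\<close> is its own negation and derivable, so it can be cut
    away.\<close>
  from HMR_cut[OF this, of "{#}"] show ?thesis using HMR_Zero[OF HMR.INIT] by simp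
qed

text \<open>Counterpart of \<open>sequent_tm\<close> among formulas. A list is used because a
  formula needs a fixed order of the summands.\<close>

definition nnf_sum :: "(posreal \<times> nnf) list \<Rightarrow> nnf" where
  "nnf_sum ws = foldr (\<lambda>(r, A). Add (Scale r A)) ws Zero"

text \<open>The cut partner that turns a sum formula back into its sequent: an identity on the sum
  with only the negated side assembled.\<close>

lemma HMR_nnf_sum: "HMR {#add_mset (1, neg (nnf_sum ws)) (mset ws)#}"
proof (induction ws)
  case Nil
  show ?case by (simp add: nnf_sum_def HMR_Zero[OF HMR.INIT])
next
  case (Cons w ws)
  obtain r A where w: "w = (r, A)" by fastforce
  have "HMR {#add_mset (r * 1, neg A) (add_mset (1, neg (nnf_sum ws)) (add_mset (r, A) (mset ws)))#}"
    using HMR_identity_add[OF Cons, of r A] by (simp add: add_mset_commute)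
  from HMR_Add[OF HMR_Scale[OF this]] show ?case by (simp add: w nnf_sum_def)
qed

text \<open>Iterated \<open>HMR_Join_inverse\<close>; the arbitrary \<open>G\<close> collects the
  components already split off.\<close>

lemma HMR_Joins_inverse:
  "HMR (add_mset {#(1, foldr Join As A)#} G) \<Longrightarrow> HMR (image_mset (\<lambda>A. {#(1, A)#}) (mset (A # As)) + G)"
proof (induction As arbitrary: G)
  case (Cons B As)
  from Cons.prems have "HMR (add_mset {#(1, foldr Join As A)#} (add_mset {#(1, B)#} G))"
    by (simp add: HMR_Join_inverse add_mset_commute)
  from Cons.IH[OF this] show ?case by (simp add: add_mset_commute)
qed simp

text \<open>Each component is cut against \<open>HMR_nnf_sum\<close>; the restored sequents
  accumulate in \<open>G\<close>.\<close>

lemma HMR_nnf_sums_inverse: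
  "HMR (image_mset (\<lambda>ws. {#(1, nnf_sum ws)#}) (mset wss) + G) \<Longrightarrow> HMR (image_mset mset (mset wss) + G)"
proof (induction wss arbitrary: G)
  case (Cons ws wss)
  from Cons.prems have "HMR (add_mset {#(1, nnf_sum ws)#} (image_mset (\<lambda>ws. {#(1, nnf_sum ws)#}) (mset wss) + G))"
    by simp
  from HMR_cut_single[OF this HMR_nnf_sum]
  have "HMR (image_mset (\<lambda>ws. {#(1, nnf_sum ws)#}) (mset wss) + add_mset (mset ws) G)" by simp
  from Cons.IH[OF this] show ?case by simp
qed simp

text \<open>The enumeration chosen inside \<open>tm_sum\<close> may differ from \<open>ws\<close>,
  but only up to derivable equality, which evaluation does not see.\<close>

lemma tm_class_sequent_tm: "tm_class (sequent_tm (mset ws)) = nnf_class (nnf_sum ws)"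
proof -
  have "tm_class (sequent_tm (mset ws)) =
      tm_class (foldr TAdd (map (\<lambda>(r, A). TScale (real_of_posreal r) (nnf_tm A)) ws) TZero)"
    unfolding sequent_tm_def mset_map[symmetric] by (rule tm_class_eq[OF tm_sum_mset])
  also have "\<dots> = tm_class (nnf_tm (nnf_sum ws))"
    by (induction ws) (auto simp: nnf_sum_def)
  finally show ?thesis by (simp add: tm_class_nnf_tm)
qed

lemma tm_class_hypersequent_tm:
  "tm_class (hypersequent_tm (image_mset mset (mset (ws # wss)))) =
    nnf_class (foldr Join (map nnf_sum wss) (nnf_sum ws))"
proof -
  have "tm_class (hypersequent_tm (image_mset mset (mset (ws # wss)))) =
      tm_class (tm_join (mset (sequent_tm (mset ws) # map (sequent_tm \<circ> mset) wss)))"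
    by (simp add: hypersequent_tm_def image_mset.compositionality)
  also have "\<dots> = tm_class (foldr TJoin (map (sequent_tm \<circ> mset) wss) (sequent_tm (mset ws)))"
    by (rule tm_class_eq[OF tm_join_mset])
  also have "\<dots> = tm_class (nnf_tm (foldr Join (map nnf_sum wss) (nnf_sum ws)))"
    by (induction wss) (simp_all add: tm_class_sequent_tm tm_class_nnf_tm)
  finally show ?thesis by (simp add: tm_class_nnf_tm)
qed

theorem theorem4p6:
  fixes G :: hypersequent
  assumes "G \<noteq> {#}"
    and "TZero \<lesssim> hypersequent_tm G"
  shows "HMR G"
proof -
  obtain \<Gamma>s where \<Gamma>s: "G = mset \<Gamma>s" by (metis ex_mset)
  \<comment> \<open>Every sequent gets an enumeration, so that \<open>nnf_sum\<close> can be
    formed.\<close>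
  have "\<exists>wss. \<Gamma>s = map mset wss"
    by (rule exI[of _ "map (\<lambda>\<Gamma>. SOME ws. mset ws = \<Gamma>) \<Gamma>s"])
      (simp add: comp_def map_idI someI_ex[OF ex_mset])
  then obtain ws wss where G: "G = image_mset mset (mset (ws # wss))"
    using assms(1) \<Gamma>s by (metis list.exhaust list.map_disc_iff mset_map mset_zero_iff)
  \<comment> \<open>The hypothesis is an equation between terms, so it holds after evaluation in the
    quotient.\<close>
  have "inf 0 (tm_class (hypersequent_tm G)) = 0"
    using tm_class_eq[OF assms(2)[unfolded mrs_le_def]] by simp
  then have "0 \<le> nnf_class (foldr Join (map nnf_sum wss) (nnf_sum ws))"
    unfolding G tm_class_hypersequent_tm by (simp add: inf.absorb_iff1)
  \<comment> \<open>The derivable formula is taken apart from the outside: first the joins, then the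
    sums.\<close>
  from HMR_Joins_inverse[OF HMR_of_nonneg[OF this]]
  have "HMR (image_mset (\<lambda>ws. {#(1, nnf_sum ws)#}) (mset (ws # wss)) + {#})"
    by (simp add: image_mset.compositionality comp_def)
  from HMR_nnf_sums_inverse[OF this] show ?thesis unfolding G by simp
qed

end
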